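(* Let $\mathcal{A}=(a_{i_1\cdots i_k})\in\mathbb{R}^{n\times\cdots\times n}$ with $k\ge3$. Then $\mathcal{A}$ has an order $2$ sign left inverse if and only if both of the following hold: (1) all entries of $\mathcal{A}$ are zero except possibly the entries $a_{ij\cdots j}$ ($i,j\in[n]$); (2) the majorization matrix $\mathbb{M}(\mathcal{A})$ is an SNS matrix.
   Context: For dimension $n$ tensors $\mathcal{A}=(a_{i_1\cdots i_m})$ (order $m\ge2$) and $\mathcal{B}=(b_{i_1\cdots i_k})$, the product $\mathcal{A}\cdot\mathcal{B}$ has entries $(\mathcal{A}\cdot\mathcal{B})_{i\alpha_1\cdots\alpha_{m-1}}=\sum_{i_2,\ldots,i_m\in[n]}a_{ii_2\cdots i_m}b_{i_2\alpha_1}\cdots b_{i_m\alpha_{m-1}}$, $\alpha_j\in[n]^{k-1}$. $\mathcal{I}$ is the order $k$ dimension $n$ unit tensor ($1$ if all indices equal, $0$ otherwise). An order $2$ left inverse of $\mathcal{B}$ is an $n\times n$ matrix $P$ with $P\cdot\mathcal{B}=\mathcal{I}$. $\mathcal{Q}(\mathcal{A})$ is the set of real tensors (or matrices) with the same entrywise sign pattern as $\mathcal{A}$; $\mathcal{A}$ has an order $2$ sign left inverse if every tensor in $\mathcal{Q}(\mathcal{A})$ has an order $2$ left inverse. The majorization matrix $\mathbb{M}(\mathcal{A})=(m_{ij})\in\mathbb{R}^{n\times n}$ has $m_{ij}=a_{ij\cdots j}$. A square real matrix $A$ is an SNS (sign nonsingular) matrix if every matrix in $\mathcal{Q}(A)$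 is nonsingular. *)

theory Defs
  imports "HOL-Analysis.Analysis"
begin

text \<open>
  A tensor of order \<open>k\<close> and dimension \<open>n = CARD('n)\<close> is a function on index lists over \<open>'n\<close>;
  only its values on lists of length \<open>k\<close> are meaningful, and every notion below
  that depends on the order takes it as an explicit argument and looks at those values only.
\<close>

type_synonym 'n tensor = "'n list \<Rightarrow> real"

definition tensor_of_matrix :: "real ^ 'n ^ 'n \<Rightarrow> 'n::finite tensor" where
  "tensor_of_matrix P = (\<lambda>idx. P $ (idx ! 0) $ (idx ! 1))"

text \<open>
  The product of \<open>A\<close> of order \<open>m\<close> and \<open>B\<close> of order \<open>k\<close> has order \<open>(m - 1) * (k - 1) + 1\<close>.
  Its index list is \<open>i\<close> followed by the concatenation of the \<open>m - 1\<close> blocks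
  \<open>\<alpha>\<^sub>1, \<dots>\<close>, each of length \<open>k - 1\<close>; the block number \<open>r\<close> below is counted from 0.
\<close>

definition tensor_prod :: "nat \<Rightarrow> nat \<Rightarrow> 'n::finite tensor \<Rightarrow> 'n tensor \<Rightarrow> 'n tensor" where
  "tensor_prod m k A B = (\<lambda>idx.
     \<Sum>js\<in>{js. length js = m - 1}.
       A (hd idx # js) *
       (\<Prod>r<m - 1. B (js ! r # take (k - 1) (drop (r * (k - 1)) (tl idx)))))"

definition unit_tensor :: "'n::finite tensor" where
  "unit_tensor = (\<lambda>idx. if \<forall>i\<in>set idx. \<forall>j\<in>set idx. i = j then 1 else 0)"

definition order2_left_inverse :: "nat \<Rightarrow> real ^ 'n ^ 'n \<Rightarrow> 'n::finite tensor \<Rightarrow> bool" where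
  "order2_left_inverse k P B \<longleftrightarrow>
     (\<forall>idx. length idx = k \<longrightarrow> tensor_prod 2 k (tensor_of_matrix P) B idx = unit_tensor idx)"

definition tensor_sign_class :: "nat \<Rightarrow> 'n::finite tensor \<Rightarrow> 'n tensor set" where
  "tensor_sign_class k A = {B. \<forall>idx. length idx = k \<longrightarrow> sgn (B idx) = sgn (A idx)}"

definition has_order2_sign_left_inverse :: "nat \<Rightarrow> 'n::finite tensor \<Rightarrow> bool" where
  "has_order2_sign_left_inverse k A \<longleftrightarrow>
     (\<forall>B\<in>tensor_sign_class k A. \<exists>P. order2_left_inverse k P B)"

definition majorization_matrix :: "nat \<Rightarrow> 'n::finite tensor \<Rightarrow> real ^ 'n ^ 'n" where
  "majorization_matrix k A = (\<chi> i j. A (i # replicate (k - 1) j))"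

definition matrix_sign_class :: "real ^ 'n ^ 'n \<Rightarrow> (real ^ 'n ^ 'n::finite) set" where
  "matrix_sign_class M = {N. \<forall>i j. sgn (N $ i $ j) = sgn (M $ i $ j)}"

definition SNS_matrix :: "real ^ 'n ^ 'n::finite \<Rightarrow> bool" where
  "SNS_matrix M \<longleftrightarrow> (\<forall>N\<in>matrix_sign_class M. invertible N)"

end

theory Submission
  imports Defs
begin

text \<open>
  For a matrix \<open>P\<close>, the equation \<open>P \<cdot> B = I\<close> splits over the columns \<open>B (_ # t)\<close>.
  The constant \<open>t\<close> give \<open>P ** M(B) = mat 1\<close>, so \<open>P\<close> is invertible; every other \<open>t\<close> gives
  a column killed by \<open>P\<close>, hence zero. So \<open>B\<close> has an order 2 left inverse iff it vanishes off its
  majorization entries and \<open>M(B)\<close> is invertible, and both conditions are compatible with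
  passing to sign classes, since every matrix with the sign pattern of \<open>M(A)\<close> is the
  majorization matrix of a tensor with the sign pattern of \<open>A\<close>.
\<close>

text \<open>For order 2 the summation lists \<open>js\<close> are singletons and the product over
  blocks has the single factor \<open>r = 0\<close>. The \<open>take\<close> remains because the
  length of \<open>t\<close> is left open.\<close>

lemma tensor_prod_matrix:
  "tensor_prod 2 k (tensor_of_matrix P) B (i # t) = (\<Sum>j\<in>UNIV. P $ i $ j * B (j # take (k - 1) t))"
proof -
  have "{js :: 'a list. length js = 1} = (\<lambda>j. [j]) ` UNIV"
    by (auto simp: length_Suc_conv)
  then show ?thesis
    by (simp add: tensor_prod_def tensor_of_matrix_def sum.reindex inj_on_def)
qed

lemma unit_tensor_Cons_replicate:
  assumes "m > 0"
  shows "unit_tensor (i # replicate m j) = (if i = j then 1 else 0)"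
  using assms by (auto simp: unit_tensor_def)

lemma unit_tensor_Cons_eq_0:
  assumes "\<nexists>j. t = replicate (length t) j"
  shows "unit_tensor (i # t) = 0"
proof -
  have "\<not> (\<forall>x\<in>set t. x = i)"
    using assms replicate_length_same by metis
  then show ?thesis
    by (auto simp: unit_tensor_def)
qed

definition majorization_supported :: "nat \<Rightarrow> 'n::finite tensor \<Rightarrow> bool" where
  "majorization_supported k B \<longleftrightarrow>
     (\<forall>idx. length idx = k \<and> (\<nexists>i j. idx = i # replicate (k - 1) j) \<longrightarrow> B idx = 0)"

lemma order2_left_inverse_iff:
  fixes B :: "'n::finite tensor"
  assumes "k \<ge> 2"
  shows "order2_left_inverse k P B \<longleftrightarrow>
    P ** majorization_matrix k B = mat 1 \<and> majorization_supported k B"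
proof
  assume "order2_left_inverse k P B"
  then have eq: "(\<Sum>j\<in>UNIV. P $ i $ j * B (j # t)) = unit_tensor (i # t)"
    if "length t = k - 1" for i t
    using that assms tensor_prod_matrix[of k P B i t]
    by (auto simp: order2_left_inverse_def)
  have PM: "P ** majorization_matrix k B = mat 1"
    using assms
    by (simp add: vec_eq_iff matrix_matrix_mult_def majorization_matrix_def eq
        unit_tensor_Cons_replicate mat_def)
  have "B (h # t) = 0" if t: "length t = k - 1" "\<nexists>j. t = replicate (k - 1) j" for h t
  proof -
    \<comment> \<open>The column of \<open>B\<close> at a fixed non-constant \<open>t\<close>: every
      \<open>i # t\<close> is then off the diagonal of the unit tensor, so \<open>P\<close> kills
      \<open>v\<close>.\<close>
    define v where "v = (\<chi> j. B (j # t))"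
    have "P *v v = 0"
      using t by (simp add: vec_eq_iff matrix_vector_mult_def v_def eq unit_tensor_Cons_eq_0)
    \<comment> \<open>For square matrices a one-sided inverse is two-sided, so \<open>P\<close> can
      be cancelled from \<open>P *v v = 0\<close>.\<close>
    moreover have "majorization_matrix k B ** P = mat 1"
      using PM matrix_left_right_inverse by blast
    ultimately have "v = 0"
      by (metis matrix_vector_mul_assoc matrix_vector_mul_lid matrix_vector_mult_0_right)
    then show ?thesis
      by (simp add: v_def vec_eq_iff)
  qed
  then have "B idx = 0" if "length idx = k" "\<nexists>i j. idx = i # replicate (k - 1) j" for idx
    using that assms by (cases idx) auto
  then have "majorization_supported k B"
    by (simp add: majorization_supported_def)
  with PM show "P ** majorization_matrix k B = mat 1 \<and> majorization_supported k B" ..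
next
  assume *: "P ** majorization_matrix k B = mat 1 \<and> majorization_supported k B"
  have "(\<Sum>j\<in>UNIV. P $ i $ j * B (j # t)) = unit_tensor (i # t)"
    if t: "length t = k - 1" for i t
  proof (cases "\<exists>j. t = replicate (k - 1) j")
    case True
    then obtain j where j: "t = replicate (k - 1) j" ..
    have "(P ** majorization_matrix k B) $ i $ j = mat 1 $ i $ j"
      using * by simp
    then show ?thesis
      using assms
      by (simp add: j matrix_matrix_mult_def majorization_matrix_def
          unit_tensor_Cons_replicate mat_def)
  next
    case False
    then have "B (j # t) = 0" for j
      using * t assms by (auto simp: majorization_supported_def)
    then show ?thesis
      using False t by (simp add: unit_tensor_Cons_eq_0)
  qed
  then have "tensor_prod 2 k (tensor_of_matrix P) B idx = unit_tensor idx"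
    if "length idx = k" for idx
    using that assms by (cases idx) (auto simp: tensor_prod_matrix)
  then show "order2_left_inverse k P B"
    by (simp add: order2_left_inverse_def)
qed

lemma has_order2_left_inverse_iff:
  fixes B :: "'n::finite tensor"
  assumes "k \<ge> 2"
  shows "(\<exists>P. order2_left_inverse k P B) \<longleftrightarrow>
    majorization_supported k B \<and> invertible (majorization_matrix k B)"
  by (auto simp: order2_left_inverse_iff[OF assms] invertible_left_inverse)

lemma majorization_supported_sign_class:
  assumes "B \<in> tensor_sign_class k A"
  shows "majorization_supported k B \<longleftrightarrow> majorization_supported k A"
proof -
  have "sgn (B idx) = sgn (A idx)" if "length idx = k" for idx
    using assms that by (simp add: tensor_sign_class_def)
  then have "B idx = 0 \<longleftrightarrow> A idx = 0" if "length idx = k" for idx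
    using that by (metis sgn_eq_0_iff)
  then show ?thesis
    by (auto simp: majorization_supported_def)
qed

text \<open>This turns a quantifier over tensors into one over matrices. The inclusion from right to
  left carries the content: every sign-equivalent matrix must be realised by a tensor of the
  class.\<close>

lemma majorization_matrix_sign_class:
  fixes A :: "'n::finite tensor"
  assumes "k \<ge> 2"
  shows "majorization_matrix k ` tensor_sign_class k A
    = matrix_sign_class (majorization_matrix k A)"
proof (intro equalityI subsetI)
  fix N assume "N \<in> majorization_matrix k ` tensor_sign_class k A"
  then obtain B where B: "B \<in> tensor_sign_class k A" and N: "N = majorization_matrix k B"
    by blast
  have "sgn (B (i # replicate (k - 1) j)) = sgn (A (i # replicate (k - 1) j))" for i j
    using B assms unfolding tensor_sign_class_def by simp
  then show "N \<in> matrix_sign_class (majorization_matrix k A)"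
    by (simp add: N matrix_sign_class_def majorization_matrix_def)
next
  fix N assume N: "N \<in> matrix_sign_class (majorization_matrix k A)"
  \<comment> \<open>\<open>A\<close> with its majorization entries overwritten by those of
    \<open>N\<close>. Since \<open>k - 1 > 0\<close>, \<open>last idx\<close> recovers
    \<open>j\<close>.\<close>
  define B where "B = (\<lambda>idx. if \<exists>i j. idx = i # replicate (k - 1) j
    then N $ hd idx $ last idx else A idx)"
  have B_major: "B (i # replicate (k - 1) j) = N $ i $ j" for i j
    using assms by (auto simp: B_def)
  have "B \<in> tensor_sign_class k A"
    unfolding tensor_sign_class_def
  proof (intro CollectI allI impI)
    fix idx :: "'n list"
    show "sgn (B idx) = sgn (A idx)"
    proof (cases "\<exists>i j. idx = i # replicate (k - 1) j")
      case True
      then show ?thesis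
        using N B_major by (auto simp: matrix_sign_class_def majorization_matrix_def)
    qed (simp add: B_def)
  qed
  moreover have "majorization_matrix k B = N"
    by (simp only: majorization_matrix_def B_major vec_lambda_eta)
  ultimately show "N \<in> majorization_matrix k ` tensor_sign_class k A"
    by blast
qed

theorem theorem4p4:
  fixes A :: "'n::finite tensor" and k :: nat
  assumes "k \<ge> 3"
  shows "has_order2_sign_left_inverse k A \<longleftrightarrow>
    (\<forall>idx. length idx = k \<and> (\<nexists>i j. idx = i # replicate (k - 1) j) \<longrightarrow> A idx = 0) \<and>
    SNS_matrix (majorization_matrix k A)"
proof -
  have k: "k \<ge> 2"
    using assms by simp
  have A: "A \<in> tensor_sign_class k A"
    by (simp add: tensor_sign_class_def)
  have "has_order2_sign_left_inverse k A \<longleftrightarrow>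
      majorization_supported k A \<and>
      (\<forall>B\<in>tensor_sign_class k A. invertible (majorization_matrix k B))"
    \<comment> \<open>The support condition is constant on the sign class, so it leaves the
      quantifier; the member \<open>A\<close> shows that the class is nonempty.\<close>
    using A majorization_supported_sign_class
    unfolding has_order2_sign_left_inverse_def has_order2_left_inverse_iff[OF k] by blast
  also have "(\<forall>B\<in>tensor_sign_class k A. invertible (majorization_matrix k B)) \<longleftrightarrow>
      SNS_matrix (majorization_matrix k A)"
    unfolding SNS_matrix_def majorization_matrix_sign_class[OF k, symmetric] by simp
  finally show ?thesis
    by (simp only: majorization_supported_def)
qed

end
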